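(* Let $r_l\in\mathbb{R}$ for $l=0,1,2,\dots$. If the terms of the quaternionic power series $\sum_{l=0}^{\infty} r_l p^l$ are bounded at some point $p_0\in\mathbb{H}$, i.e. $|r_l p_0^l|\le M$ for $l=0,1,2,\dots$, where $M>0$ is a constant, then this series converges in the open connected ball $B(0,|p_0|)=\{p\in\mathbb{H}: |p|<|p_0|\}$. Moreover, it converges absolutely and uniformly on any compact subset $K$ that is properly contained in $B(0,|p_0|)$.
   Context: $\mathbb{H}$ is the algebra of quaternions with norm $|p|=\sqrt{x^2+y^2+z^2+u^2}$ for $p=x+yi+zj+uk$. The series $\sum_{l=0}^\infty r_l p^l$ converges if its partial sums $S_n(p)=\sum_{l=0}^n r_l p^l$ converge; it converges absolutely if $\sum_{l=0}^\infty |r_l p^l|$ converges; it converges uniformly on a set $K$ to $S(p)$ if it converges to $S(p)$ at all $p\in K$ and for every $\epsilon>0$ there is an integer $N_\epsilon>0$ depending only on $\epsilon$ such that $|S_n(p)-S(p)|<\epsilon$ for all $n\ge N_\epsilon$ and all $p\in K$. *)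

theory Defs
  imports "HOL-Analysis.Analysis"
begin

text \<open>
  The quaternion \<open>Quat x y z u\<close> is $x + yi + zj + uk$. The type is made a real normed division
  algebra and a Euclidean space, so that powers, summability, compactness and uniform limits
  are those of the library.
\<close>

datatype quat = Quat (qre: real) (qi: real) (qj: real) (qk: real)

lemma quat_eq_iff:
  "p = q \<longleftrightarrow> qre p = qre q \<and> qi p = qi q \<and> qj p = qj q \<and> qk p = qk q"
  by (cases p; cases q) simp


subsection \<open>Algebra\<close>

instantiation quat :: ab_group_add
begin

definition zero_quat_def: "0 = Quat 0 0 0 0"

definition plus_quat_def:
  "p + q = Quat (qre p + qre q) (qi p + qi q) (qj p + qj q) (qk p + qk q)"

definition minus_quat_def:
  "p - q = Quat (qre p - qre q) (qi p - qi q) (qj p - qj q) (qk p - qk q)"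

definition uminus_quat_def:
  "- p = Quat (- qre p) (- qi p) (- qj p) (- qk p)"

instance
  by standard
    (simp_all add: zero_quat_def plus_quat_def minus_quat_def uminus_quat_def quat_eq_iff)

end

lemma quat_sel_additive [simp]:
  "qre 0 = 0" "qi 0 = 0" "qj 0 = 0" "qk 0 = 0"
  "qre (p + q) = qre p + qre q" "qi (p + q) = qi p + qi q"
  "qj (p + q) = qj p + qj q" "qk (p + q) = qk p + qk q"
  "qre (p - q) = qre p - qre q" "qi (p - q) = qi p - qi q"
  "qj (p - q) = qj p - qj q" "qk (p - q) = qk p - qk q"
  "qre (- p) = - qre p" "qi (- p) = - qi p" "qj (- p) = - qj p" "qk (- p) = - qk p"
  by (simp_all add: zero_quat_def plus_quat_def minus_quat_def uminus_quat_def)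

text \<open>
  The product is the bilinear one determined by $i^2 = j^2 = k^2 = ijk = -1$; the inverse of
  \<open>p\<close> is the conjugate of \<open>p\<close> divided by $|p|^2$.
\<close>

instantiation quat :: "{real_algebra_1, division_ring}"
begin

definition one_quat_def: "1 = Quat 1 0 0 0"

definition scaleR_quat_def:
  "a *\<^sub>R p = Quat (a * qre p) (a * qi p) (a * qj p) (a * qk p)"

definition times_quat_def:
  "p * q = Quat
     (qre p * qre q - qi p * qi q - qj p * qj q - qk p * qk q)
     (qre p * qi q + qi p * qre q + qj p * qk q - qk p * qj q)
     (qre p * qj q - qi p * qk q + qj p * qre q + qk p * qi q)
     (qre p * qk q + qi p * qj q - qj p * qi q + qk p * qre q)"

definition inverse_quat_def:
  "inverse p = (1 / ((qre p)\<^sup>2 + (qi p)\<^sup>2 + (qj p)\<^sup>2 + (qk p)\<^sup>2)) *\<^sub>R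
     Quat (qre p) (- qi p) (- qj p) (- qk p)"

definition divide_quat_def: "p div q = p * inverse (q :: quat)"

lemma quat_sel_algebra [simp]:
  "qre 1 = 1" "qi 1 = 0" "qj 1 = 0" "qk 1 = 0"
  "qre (a *\<^sub>R p) = a * qre p" "qi (a *\<^sub>R p) = a * qi p"
  "qj (a *\<^sub>R p) = a * qj p" "qk (a *\<^sub>R p) = a * qk p"
  by (simp_all add: one_quat_def scaleR_quat_def)

lemma quat_sum_squares_pos:
  assumes "p \<noteq> 0"
  shows "0 < (qre p)\<^sup>2 + (qi p)\<^sup>2 + (qj p)\<^sup>2 + (qk p)\<^sup>2"
proof -
  have "qre p \<noteq> 0 \<or> qi p \<noteq> 0 \<or> qj p \<noteq> 0 \<or> qk p \<noteq> 0"
    using assms by (auto simp: quat_eq_iff)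
  then have "0 < (qre p)\<^sup>2 \<or> 0 < (qi p)\<^sup>2 \<or> 0 < (qj p)\<^sup>2 \<or> 0 < (qk p)\<^sup>2"
    by simp
  then show ?thesis
    using zero_le_power2[of "qre p"] zero_le_power2[of "qi p"]
      zero_le_power2[of "qj p"] zero_le_power2[of "qk p"]
    by linarith
qed

instance
proof
  fix p q s :: quat and a b :: real
  show "p * q * s = p * (q * s)"
    by (simp add: times_quat_def quat_eq_iff algebra_simps)
  show "1 * p = p" "p * 1 = p"
    by (simp_all add: times_quat_def quat_eq_iff)
  show "(p + q) * s = p * s + q * s" "p * (q + s) = p * q + p * s"
    by (simp_all add: times_quat_def quat_eq_iff algebra_simps)
  show "(0 :: quat) \<noteq> 1"
    by (simp add: quat_eq_iff)
  show "a *\<^sub>R (p + q) = a *\<^sub>R p + a *\<^sub>R q" "(a + b) *\<^sub>R p = a *\<^sub>R p + b *\<^sub>R p"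
    "a *\<^sub>R b *\<^sub>R p = (a * b) *\<^sub>R p" "1 *\<^sub>R p = p"
    by (simp_all add: quat_eq_iff algebra_simps)
  show scaleR_left: "a *\<^sub>R p * q = a *\<^sub>R (p * q)"
    and scaleR_right: "p * a *\<^sub>R q = a *\<^sub>R (p * q)" for a and p q :: quat
    by (simp_all add: times_quat_def quat_eq_iff algebra_simps)
  show "inverse p * p = 1" "p * inverse p = 1" if "p \<noteq> 0"
  proof -
    define n where "n = (qre p)\<^sup>2 + (qi p)\<^sup>2 + (qj p)\<^sup>2 + (qk p)\<^sup>2"
    define c where "c = Quat (qre p) (- qi p) (- qj p) (- qk p)"
    have "n \<noteq> 0"
      using quat_sum_squares_pos[OF that] unfolding n_def by linarith
    have inv: "inverse p = (1 / n) *\<^sub>R c"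
      by (simp only: inverse_quat_def n_def c_def)
    have "c * p = n *\<^sub>R 1" "p * c = n *\<^sub>R 1"
      by (simp_all add: times_quat_def c_def n_def quat_eq_iff power2_eq_square)
    then show "inverse p * p = 1" "p * inverse p = 1"
      using \<open>n \<noteq> 0\<close> by (simp_all add: inv scaleR_left scaleR_right quat_eq_iff)
  qed
  show "p div q = p * inverse q"
    by (rule divide_quat_def)
  show "inverse (0 :: quat) = 0"
    by (simp add: inverse_quat_def quat_eq_iff)
qed

end


subsection \<open>Norm and topology\<close>

instantiation quat :: real_inner
begin

definition inner_quat_def:
  "p \<bullet> q = qre p * qre q + qi p * qi q + qj p * qj q + qk p * qk q"

definition norm_quat_def:
  "norm p = sqrt ((qre p)\<^sup>2 + (qi p)\<^sup>2 + (qj p)\<^sup>2 + (qk p)\<^sup>2)"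

definition sgn_quat_def: "sgn p = p /\<^sub>R norm (p :: quat)"

definition dist_quat_def: "dist p q = norm (p - q :: quat)"

definition uniformity_quat_def:
  "(uniformity :: (quat \<times> quat) filter) = (INF e\<in>{0 <..}. principal {(p, q). dist p q < e})"

definition open_quat_def:
  "open (U :: quat set) \<longleftrightarrow> (\<forall>p\<in>U. eventually (\<lambda>(p', q). p' = p \<longrightarrow> q \<in> U) uniformity)"

instance
proof
  fix p q s :: quat and a :: real and U :: "quat set"
  show "dist p q = norm (p - q)"
    by (rule dist_quat_def)
  show "sgn p = p /\<^sub>R norm p"
    by (rule sgn_quat_def)
  show "(uniformity :: (quat \<times> quat) filter) = (INF e\<in>{0 <..}. principal {(p, q). dist p q < e})"
    by (rule uniformity_quat_def)
  show "open U \<longleftrightarrow> (\<forall>p\<in>U. eventually (\<lambda>(p', q). p' = p \<longrightarrow> q \<in> U) uniformity)"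
    by (rule open_quat_def)
  show "p \<bullet> q = q \<bullet> p"
    by (simp add: inner_quat_def mult.commute)
  show "(p + q) \<bullet> s = p \<bullet> s + q \<bullet> s" "a *\<^sub>R p \<bullet> q = a * (p \<bullet> q)"
    by (simp_all add: inner_quat_def algebra_simps)
  show "0 \<le> p \<bullet> p"
    by (simp add: inner_quat_def)
  show "p \<bullet> p = 0 \<longleftrightarrow> p = 0"
  proof
    assume "p \<bullet> p = 0"
    then show "p = 0"
      using quat_sum_squares_pos[of p] by (force simp: inner_quat_def power2_eq_square)
  qed (simp add: inner_quat_def)
  show "norm p = sqrt (p \<bullet> p)"
    by (simp add: inner_quat_def norm_quat_def power2_eq_square)
qed

end

instance quat :: real_normed_div_algebra
proof
  fix p q :: quat
  have "(a*b - c*d - e*f - g*h)\<^sup>2 + (a*d + c*b + e*h - g*f)\<^sup>2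
      + (a*f - c*h + e*b + g*d)\<^sup>2 + (a*h + c*f - e*d + g*b)\<^sup>2
      = (a\<^sup>2 + c\<^sup>2 + e\<^sup>2 + g\<^sup>2) * (b\<^sup>2 + d\<^sup>2 + f\<^sup>2 + h\<^sup>2)"
    for a b c d e f g h :: real
    by algebra
  then show "norm (p * q) = norm p * norm q"
    by (simp only: norm_quat_def times_quat_def quat.sel real_sqrt_mult)
qed

instantiation quat :: euclidean_space
begin

definition Basis_quat_def:
  "Basis = {Quat 1 0 0 0, Quat 0 1 0 0, Quat 0 0 1 0, Quat 0 0 0 1}"

instance
proof
  fix p q :: quat
  show "(Basis :: quat set) \<noteq> {}" "finite (Basis :: quat set)"
    by (simp_all add: Basis_quat_def)
  show "p \<bullet> q = (if p = q then 1 else 0)" if "p \<in> Basis" "q \<in> Basis"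
    using that unfolding Basis_quat_def
    by (elim insertE emptyE) (simp_all add: inner_quat_def)
  show "(\<forall>q\<in>Basis. p \<bullet> q = 0) \<longleftrightarrow> p = 0"
    by (cases p) (simp add: Basis_quat_def inner_quat_def zero_quat_def)
qed

end

end

theory Submission
  imports Defs
begin

text \<open>
  If \<open>|p| \<le> \<rho> < |p\<^sub>0|\<close>, then \<open>|r\<^sub>l p\<^sup>l| \<le> M (\<rho> / |p\<^sub>0|)\<^sup>l\<close>, a convergent geometric
  majorant that does not depend on \<open>p\<close>. Since the norm attains its maximum on a compact \<open>K\<close>,
  a single \<open>\<rho>\<close> serves all of \<open>K\<close>, and the Weierstrass M-test applies.
\<close>

text \<open>The norm of a division algebra is multiplicative, so passing from \<open>q\<close> to
  \<open>p\<close> scales the norm of the n-th term by exactly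
  \<open>(norm p / norm q) ^ n\<close>.\<close>

lemma norm_power_term_le:
  fixes p q :: "'a::real_normed_div_algebra"
  assumes bound: "norm (a *\<^sub>R q ^ n) \<le> M" and "norm p \<le> \<rho>" and "q \<noteq> 0"
  shows "norm (a *\<^sub>R p ^ n) \<le> M * (\<rho> / norm q) ^ n"
proof -
  have "norm (a *\<^sub>R p ^ n) = norm (a *\<^sub>R q ^ n) * (norm p / norm q) ^ n"
    using \<open>q \<noteq> 0\<close> by (simp add: norm_power power_divide)
  also have "\<dots> \<le> M * (\<rho> / norm q) ^ n"
    \<comment> \<open>\<open>mult_mono\<close> needs 0 \<le> \<open>M\<close>; this follows from
      \<open>bound\<close>, since a norm is nonnegative.\<close>
    using assms by (intro mult_mono power_mono divide_right_mono order_trans[OF norm_ge_zero bound]) auto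
  finally show ?thesis .
qed

text \<open>Comparison with the geometric majorant for \<rho> = \<open>norm p\<close>, whose ratio
  is below 1.\<close>

lemma power_series_bounded_terms_summable_norm:
  fixes p q :: "'a::real_normed_div_algebra"
  assumes "\<And>n. norm (a n *\<^sub>R q ^ n) \<le> M" and "norm p < norm q"
  shows "summable (\<lambda>n. norm (a n *\<^sub>R p ^ n))"
proof (rule summable_comparison_test')
  have "q \<noteq> 0" using assms(2) by auto
  show "summable (\<lambda>n. M * (norm p / norm q) ^ n)"
    using assms(2) by (intro summable_mult summable_geometric) (simp add: divide_simps)
  show "norm (norm (a n *\<^sub>R p ^ n)) \<le> M * (norm p / norm q) ^ n" if "0 \<le> n" for n
    using norm_power_term_le[OF assms(1) order_refl \<open>q \<noteq> 0\<close>] by (simp only: real_norm_def abs_norm_cancel)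
qed

lemma power_series_bounded_terms_uniform_limit:
  fixes q :: "'a::{real_normed_div_algebra, banach}" and K :: "'a set"
  assumes "\<And>n. norm (a n *\<^sub>R q ^ n) \<le> M" and "compact K" and "K \<subseteq> ball 0 (norm q)"
  shows "uniform_limit K (\<lambda>n p. \<Sum>l\<le>n. a l *\<^sub>R p ^ l) (\<lambda>p. \<Sum>l. a l *\<^sub>R p ^ l) sequentially"
proof (cases "K = {}")
  case True
  then show ?thesis by (simp add: uniform_limit_iff)
next
  case False
  \<comment> \<open>The maximum is attained inside the open ball, so the common radius
    \<open>norm m\<close> stays strictly below \<open>norm q\<close>; a mere supremum could equal
    it.\<close>
  obtain m where "m \<in> K" and max: "\<And>p. p \<in> K \<Longrightarrow> norm p \<le> norm m"
    using continuous_attains_sup[OF \<open>compact K\<close> False continuous_on_norm_id] by auto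
  with \<open>K \<subseteq> _\<close> have less: "norm m < norm q" by auto
  then have "q \<noteq> 0" by auto
  have "uniform_limit K (\<lambda>n p. \<Sum>l<n. a l *\<^sub>R p ^ l) (\<lambda>p. \<Sum>l. a l *\<^sub>R p ^ l) sequentially"
  proof (rule Weierstrass_m_test)
    show "norm (a n *\<^sub>R p ^ n) \<le> M * (norm m / norm q) ^ n" if "p \<in> K" for n p
      by (rule norm_power_term_le[OF assms(1) max[OF that] \<open>q \<noteq> 0\<close>])
    show "summable (\<lambda>n. M * (norm m / norm q) ^ n)"
      using less by (intro summable_mult summable_geometric) (simp add: divide_simps)
  qed
  \<comment> \<open>The M-test speaks of sums over \<open>l < n\<close>; composing the limit with
    \<open>Suc\<close> turns them into the partial sums over \<open>l \<le> n\<close>.\<close>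
  from filterlim_compose[OF this filterlim_Suc] show ?thesis
    by (simp only: lessThan_Suc_atMost)
qed

theorem proposition3p8:
  fixes r :: "nat \<Rightarrow> real" and p0 :: quat and M :: real
  assumes "M > 0"
    and "\<And>l. norm (r l *\<^sub>R p0 ^ l) \<le> M"
  shows "(\<forall>p \<in> ball (0 :: quat) (norm p0). summable (\<lambda>l. r l *\<^sub>R p ^ l)) \<and>
    (\<forall>K. compact K \<and> K \<subset> ball (0 :: quat) (norm p0) \<longrightarrow>
      (\<forall>p\<in>K. summable (\<lambda>l. norm (r l *\<^sub>R p ^ l))) \<and>
      uniform_limit K (\<lambda>n p. \<Sum>l\<le>n. r l *\<^sub>R p ^ l) (\<lambda>p. \<Sum>l. r l *\<^sub>R p ^ l) sequentially)"
proof -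
  have abs: "summable (\<lambda>l. norm (r l *\<^sub>R p ^ l))" if "p \<in> ball 0 (norm p0)" for p :: quat
    using power_series_bounded_terms_summable_norm[OF assms(2)] that by simp
  show ?thesis
  proof (intro conjI ballI allI impI)
    show "summable (\<lambda>l. r l *\<^sub>R p ^ l)" if "p \<in> ball 0 (norm p0)" for p :: quat
      \<comment> \<open>Absolute convergence implies convergence because \<open>quat\<close>, as a
        Euclidean space, is complete.\<close>
      by (rule summable_norm_cancel[OF abs[OF that]])
  next
    fix K :: "quat set"
    assume K: "compact K \<and> K \<subset> ball 0 (norm p0)"
    then show "summable (\<lambda>l. norm (r l *\<^sub>R p ^ l))" if "p \<in> K" for p
      using abs that by blast
    show "uniform_limit K (\<lambda>n p. \<Sum>l\<le>n. r l *\<^sub>R p ^ l) (\<lambda>p. \<Sum>l. r l *\<^sub>R p ^ l) sequentially"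
      using K by (intro power_series_bounded_terms_uniform_limit[OF assms(2)]) auto
  qed
qed

end
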